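(* Let $G$ be a connected $r$-regular graph which is not a complete graph of odd order. Then $G$ has an IPD.
   Context: All graphs are finite and simple. The order of a path is its number of vertices. A path $P$ in $G$ is induced if the subgraph of $G$ induced on $V(P)$ is exactly $P$. A graph $G$ has an IPD (induced path decomposition) if $V(G)$ can be partitioned into sets $V_1,\dots,V_t$ such that each $G[V_i]$ is a path of order at least $2$. *)

theory Defs
  imports Main
begin

definition simple_graph :: "'a set \<Rightarrow> ('a \<Rightarrow> 'a \<Rightarrow> bool) \<Rightarrow> bool" where
  "simple_graph V E \<longleftrightarrow> finite V \<and> (\<forall>x y. E x y \<longrightarrow> x \<in> V \<and> y \<in> V)
     \<and> (\<forall>x y. E x y \<longrightarrow> E y x) \<and> (\<forall>x. \<not> E x x)"

definition degree :: "'a set \<Rightarrow> ('a \<Rightarrow> 'a \<Rightarrow> bool) \<Rightarrow> 'a \<Rightarrow> nat" where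
  "degree V E v = card {u \<in> V. E v u}"

definition regular :: "'a set \<Rightarrow> ('a \<Rightarrow> 'a \<Rightarrow> bool) \<Rightarrow> nat \<Rightarrow> bool" where
  "regular V E r \<longleftrightarrow> (\<forall>v\<in>V. degree V E v = r)"

definition is_walk :: "('a \<Rightarrow> 'a \<Rightarrow> bool) \<Rightarrow> 'a list \<Rightarrow> bool" where
  "is_walk E xs \<longleftrightarrow> xs \<noteq> [] \<and> (\<forall>i. Suc i < length xs \<longrightarrow> E (xs ! i) (xs ! Suc i))"

definition connected_graph :: "'a set \<Rightarrow> ('a \<Rightarrow> 'a \<Rightarrow> bool) \<Rightarrow> bool" where
  "connected_graph V E \<longleftrightarrow> V \<noteq> {} \<and>
     (\<forall>u\<in>V. \<forall>v\<in>V. \<exists>xs. is_walk E xs \<and> hd xs = u \<and> last xs = v \<and> set xs \<subseteq> V)"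

definition complete_graph :: "'a set \<Rightarrow> ('a \<Rightarrow> 'a \<Rightarrow> bool) \<Rightarrow> bool" where
  "complete_graph V E \<longleftrightarrow> (\<forall>u\<in>V. \<forall>v\<in>V. u \<noteq> v \<longrightarrow> E u v)"

definition induces_path :: "('a \<Rightarrow> 'a \<Rightarrow> bool) \<Rightarrow> 'a set \<Rightarrow> bool" where
  "induces_path E S \<longleftrightarrow> (\<exists>xs. distinct xs \<and> set xs = S \<and>
     (\<forall>i<length xs. \<forall>j<length xs. E (xs ! i) (xs ! j) \<longleftrightarrow> (i = Suc j \<or> j = Suc i)))"

definition has_IPD :: "'a set \<Rightarrow> ('a \<Rightarrow> 'a \<Rightarrow> bool) \<Rightarrow> bool" where
  "has_IPD V E \<longleftrightarrow> (\<exists>P. \<Union>P = V \<and> (\<forall>A\<in>P. \<forall>B\<in>P. A \<noteq> B \<longrightarrow> A \<inter> B = {}) \<and>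
     (\<forall>A\<in>P. card A \<ge> 2 \<and> induces_path E A))"

end

theory Submission
  imports Defs
begin

text \<open>
  Every induced path of order at least 2 splits into edges and induced paths on three vertices, so
  take a packing of \<open>V\<close> by such pieces that leaves as few vertices single as possible, and suppose
  that \<open>x\<close> is single. Let \<open>Z\<close> be the set of centres of the three-vertex pieces. If \<open>x\<close> is adjacent
  to an end of an edge piece, minimality makes it adjacent to both ends, and either of them can become
  single in place of \<open>x\<close>; if \<open>x\<close> is adjacent to a centre, either leaf of that centre can; an edge
  from \<open>x\<close> to a leaf or to another single vertex contradicts minimality. None of these shifts
  changes \<open>Z\<close>. Hence the set \<open>D\<close> of vertices that can become single is a union of components of
  \<open>G - Z\<close>, and with \<open>S\<close> the neighbours of \<open>D\<close> in \<open>Z\<close>, the vertex \<open>x\<close> and the leaves of the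
  centres in \<open>S\<close> lie in \<open>2|S| + 1\<close> different components of \<open>D\<close>. Shifting along a cycle shows that
  all blocks of these components are cliques. Looking at an end block, in an \<open>r\<close>-regular connected
  noncomplete graph every such component sends at least \<open>r/2\<close> edges to \<open>S\<close>, whereas \<open>S\<close> receives at
  most \<open>r|S|\<close> edges, a contradiction.
\<close>

section \<open>Packings by edges and induced three-vertex paths\<close>

locale sgraph =
  fixes V :: "'a set" and E :: "'a \<Rightarrow> 'a \<Rightarrow> bool"
  assumes fin: "finite V"
    and E_V: "E x y \<Longrightarrow> x \<in> V \<and> y \<in> V"
    and sym: "E x y \<Longrightarrow> E y x"
    and irrefl: "\<not> E x x"
begin

text \<open>\<open>Z\<close> is the set of centres of the three-vertex pieces; \<open>p\<close> sends a leaf to its centre,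
  exchanges the ends of an edge piece, and fixes centres and single vertices.\<close>

definition packing :: "'a set \<Rightarrow> ('a \<Rightarrow> 'a) \<Rightarrow> bool" where
  "packing Z p \<longleftrightarrow> Z \<subseteq> V \<and> (\<forall>v\<in>V. p v \<in> V) \<and>
     (\<forall>s\<in>Z. p s = s \<and> (\<exists>a c. a \<noteq> c \<and> \<not> E a c \<and> {v \<in> V - Z. p v = s} = {a, c})) \<and>
     (\<forall>v\<in>V - Z. p v \<noteq> v \<longrightarrow> E v (p v) \<and> (p v \<notin> Z \<longrightarrow> p (p v) = v))"

definition singles :: "'a set \<Rightarrow> ('a \<Rightarrow> 'a) \<Rightarrow> 'a set" where
  "singles Z p = {v \<in> V - Z. p v = v}"

text \<open>Competitors may have other centres: \<open>optimal_edge\<close> compares with packings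
  that have one centre fewer or one more.\<close>

definition optimal :: "'a set \<Rightarrow> ('a \<Rightarrow> 'a) \<Rightarrow> bool" where
  "optimal Z p \<longleftrightarrow> packing Z p \<and>
     (\<forall>Z' p'. packing Z' p' \<longrightarrow> card (singles Z p) \<le> card (singles Z' p'))"

lemma finite_singles: "finite (singles Z p)"
  using fin by (simp add: singles_def)

lemma packing_centre:
  assumes "packing Z p" "s \<in> Z"
  obtains a c where "a \<noteq> c" "\<not> E a c" "{v \<in> V - Z. p v = s} = {a, c}"
  using assms unfolding packing_def by blast

lemma packing_edge:
  assumes "packing Z p" "v \<in> V - Z" "p v \<noteq> v"
  shows "E v (p v)" "p v \<notin> Z \<Longrightarrow> p (p v) = v"
  using assms unfolding packing_def by blast+

section \<open>Improving and shifting an optimal packing\<close>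

lemma optimal_not_smaller:
  assumes opt: "optimal Z p" and pk: "packing Z' p'"
    and x: "x \<in> singles Z p" and sub: "singles Z' p' \<subseteq> singles Z p - {x}"
  shows False
proof -
  have "card (singles Z' p') < card (singles Z p)"
    using x sub by (intro psubset_card_mono finite_singles) blast
  then show False using opt pk unfolding optimal_def by (meson leD)
qed

text \<open>Each failure lets \<open>x\<close> be absorbed. If \<open>a\<close> is single,
  \<open>xa\<close> is a new edge piece; if \<open>a\<close> is a leaf of \<open>s\<close> with
  other leaf \<open>c\<close>, the star splits into the edges \<open>xa\<close> and
  \<open>sc\<close>; if \<open>x\<close> is not adjacent to the partner \<open>p a\<close>, then
  \<open>a\<close> becomes the centre of an induced path with leaves \<open>x\<close> and
  \<open>p a\<close>.\<close>

lemma optimal_edge: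
  assumes opt: "optimal Z p" and x: "x \<in> singles Z p" and xa: "E x a" and a: "a \<notin> Z"
  shows "p a \<noteq> a" "p a \<notin> Z" "E x (p a)"
proof -
  have pk: "packing Z p" using opt by (simp add: optimal_def)
  have xV: "x \<in> V" "x \<notin> Z" "p x = x" using x by (auto simp: singles_def)
  have aV: "a \<in> V" using E_V xa by blast
  have ne: "x \<noteq> a" using xa irrefl by blast
  have ZV: "Z \<subseteq> V" and pV: "\<And>v. v \<in> V \<Longrightarrow> p v \<in> V"
    and cen: "\<And>s. s \<in> Z \<Longrightarrow> p s = s"
      "\<And>s. s \<in> Z \<Longrightarrow> \<exists>a c. a \<noteq> c \<and> \<not> E a c \<and> {v \<in> V - Z. p v = s} = {a, c}"
    using pk unfolding packing_def by blast+
  note edg = packing_edge[OF pk]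
  show 1: "p a \<noteq> a"
  proof
    assume s: "p a = a"
    let ?p = "p(x := a, a := x)"
    have fib: "{v \<in> V - Z. ?p v = s} = {v \<in> V - Z. p v = s}" if "s \<in> Z" for s
      using that xV a s by auto
    have "packing Z ?p"
      unfolding packing_def
    proof (intro conjI ballI impI)
      fix s assume "s \<in> Z"
      then show "?p s = s" using cen xV a by auto
      show "\<exists>a c. a \<noteq> c \<and> \<not> E a c \<and> {v \<in> V - Z. ?p v = s} = {a, c}"
        using cen(2)[OF \<open>s \<in> Z\<close>] fib[OF \<open>s \<in> Z\<close>] by simp
    next
      fix v assume v: "v \<in> V - Z" "?p v \<noteq> v"
      show "E v (?p v)" using v edg(1)[of v] xa sym[OF xa] by (auto split: if_splits)
      assume "?p v \<notin> Z"
      then show "?p (?p v) = v" using v edg[of v] xV s ne by (auto split: if_splits)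
    qed (use ZV pV xV aV in auto)
    moreover have "singles Z ?p \<subseteq> singles Z p - {x}"
      using ne s by (auto simp: singles_def split: if_splits)
    ultimately show False using optimal_not_smaller[OF opt _ x] by blast
  qed
  show 2: "p a \<notin> Z"
  proof
    assume s: "p a \<in> Z"
    define s where "s = p a"
    have sZ: "s \<in> Z" using \<open>p a \<in> Z\<close> s_def by simp
    obtain a' c' where ac: "a' \<noteq> c'" "\<not> E a' c'" "{v \<in> V - Z. p v = s} = {a', c'}"
      using cen(2)[OF sZ] by blast
    have "a \<in> {v \<in> V - Z. p v = s}" using aV a s_def by simp
    then obtain c where c: "c \<noteq> a" "{v \<in> V - Z. p v = s} = {a, c}"
      using ac by (metis insert_commute insert_iff singletonD)
    have cV: "c \<in> V" "c \<notin> Z" "p c = s" using c by auto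
    have sc: "E s c" using edg(1)[of c] cV sZ sym by (metis DiffI)
    let ?p = "p(x := a, a := x, s := c)" and ?Z = "Z - {s}"
    have xs: "x \<noteq> s" "a \<noteq> s" "c \<noteq> s" "c \<noteq> x" using xV a sZ cV by auto
    have only: "v = a \<or> v = c" if "v \<in> V" "v \<notin> Z" "p v = s" for v using c that by blast
    have fib: "{v \<in> V - ?Z. ?p v = t} = {v \<in> V - Z. p v = t}" if "t \<in> Z" "t \<noteq> s" for t
      using that xV a s_def cV sZ by auto
    have "packing ?Z ?p"
      unfolding packing_def
    proof (intro conjI ballI impI)
      fix t assume t: "t \<in> ?Z"
      then show "?p t = t" using cen xV a by auto
      show "\<exists>a c. a \<noteq> c \<and> \<not> E a c \<and> {v \<in> V - ?Z. ?p v = t} = {a, c}"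
        using cen(2)[of t] fib[of t] t by simp
    next
      fix v assume v: "v \<in> V - ?Z" "?p v \<noteq> v"
      show "E v (?p v)" using v edg(1)[of v] xa sym[OF xa] sc by (auto split: if_splits)
      assume nz: "?p v \<notin> ?Z"
      consider "v = x" | "v = a" | "v = s" | "v = c" | "v \<notin> {x, a, s, c}" by blast
      then show "?p (?p v) = v"
      proof cases
        case 5
        then have "v \<in> V - Z" "p v \<noteq> v" using v by auto
        moreover have "p v \<noteq> s" using only 5 calculation by blast
        ultimately have "p v \<notin> Z" "p (p v) = v" using nz 5 edg[of v] by (auto)
        moreover have "p v \<noteq> x" "p v \<noteq> a"
          using calculation 5 xV s_def by auto
        ultimately show ?thesis using 5 \<open>p v \<noteq> s\<close> by auto
      qed (use xs ne c cV in auto)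
    qed (use ZV pV xV aV cV in auto)
    moreover have "singles ?Z ?p \<subseteq> singles Z p - {x}"
      using ne xs by (auto simp: singles_def split: if_splits)
    ultimately show False using optimal_not_smaller[OF opt _ x] by blast
  qed
  show "E x (p a)"
  proof (rule ccontr)
    assume nx: "\<not> E x (p a)"
    define b where "b = p a"
    have b: "b \<notin> Z" "b \<noteq> a" "p b = a" "b \<in> V" "E a b"
      using 1 2 edg[of a] aV a pV by (auto simp: b_def)
    have bx: "b \<noteq> x" using b xV ne by auto
    let ?p = "p(a := a, x := a)" and ?Z = "insert a Z"
    have inv: "v = b" if "v \<in> V" "v \<notin> Z" "p v = a" for v
      using edg(2)[of v] that a b_def b(2) by (cases "v = a") auto
    have "packing ?Z ?p"
      unfolding packing_def
    proof (intro conjI ballI impI)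
      fix t assume t: "t \<in> ?Z"
      then show "?p t = t" using cen xV a by auto
      show "\<exists>a c. a \<noteq> c \<and> \<not> E a c \<and> {v \<in> V - ?Z. ?p v = t} = {a, c}"
      proof (cases "t = a")
        case True
        have "{v \<in> V - ?Z. ?p v = t} = {x, b}"
          using True xV b ne bx by (auto split: if_splits dest: inv)
        then show ?thesis using nx bx unfolding b_def
          by (intro exI[of _ x] exI[of _ "p a"]) simp
      next
        case False
        then have "{v \<in> V - ?Z. ?p v = t} = {v \<in> V - Z. p v = t}"
          using t xV 2 by auto
        then show ?thesis using cen(2)[of t] t False by simp
      qed
    next
      fix v assume v: "v \<in> V - ?Z" "?p v \<noteq> v"
      show "E v (?p v)" using v edg(1)[of v] xa sym[OF xa] by (auto split: if_splits)
      assume nz: "?p v \<notin> ?Z"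
      then have "v \<noteq> x" "v \<noteq> a" "p v \<noteq> a" "p v \<notin> Z" by (auto split: if_splits)
      moreover have "p (p v) = v" using edg[of v] v calculation by auto
      moreover have "p v \<noteq> x" using calculation xV by auto
      ultimately show "?p (?p v) = v" by auto
    qed (use ZV pV xV aV in auto)
    moreover have "singles ?Z ?p \<subseteq> singles Z p - {x}"
      using ne by (auto simp: singles_def split: if_splits)
    ultimately show False using optimal_not_smaller[OF opt _ x] by blast
  qed
qed

text \<open>By \<open>optimal_edge\<close>, \<open>x\<close> can take over the partner of
  \<open>a\<close>. One single vertex is exchanged for another, which keeps the packing
  optimal.\<close>

lemma edge_shift:
  assumes opt: "optimal Z p" and x: "x \<in> singles Z p" and xa: "E x a" and a: "a \<notin> Z"
  defines "p' \<equiv> p(a := a, x := p a, p a := x)"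
  shows "optimal Z p'" "a \<in> singles Z p'"
proof -
  have pk: "packing Z p" using opt by (simp add: optimal_def)
  have xV: "x \<in> V" "x \<notin> Z" "p x = x" using x by (auto simp: singles_def)
  have aV: "a \<in> V" using E_V xa by blast
  have ne: "x \<noteq> a" using xa irrefl by blast
  have ZV: "Z \<subseteq> V" and pV: "\<And>v. v \<in> V \<Longrightarrow> p v \<in> V"
    and cen: "\<And>s. s \<in> Z \<Longrightarrow> p s = s"
      "\<And>s. s \<in> Z \<Longrightarrow> \<exists>a c. a \<noteq> c \<and> \<not> E a c \<and> {v \<in> V - Z. p v = s} = {a, c}"
    using pk unfolding packing_def by blast+
  note edg = packing_edge[OF pk]
  define b where "b = p a"
  have b: "b \<notin> Z" "b \<noteq> a" "p b = a" "b \<in> V" "E x b"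
    using optimal_edge[OF opt x xa a] edg[of a] aV a pV by (auto simp: b_def)
  have bx: "b \<noteq> x" using b xV ne by auto
  have p': "p' = p(a := a, x := b, b := x)" by (simp add: p'_def b_def)
  have "packing Z p'"
    unfolding packing_def
  proof (intro conjI ballI impI)
    fix s assume s: "s \<in> Z"
    then show "p' s = s" using cen xV a b by (auto simp: p')
    have "{v \<in> V - Z. p' v = s} = {v \<in> V - Z. p v = s}"
      using s xV a b b_def by (auto simp: p' split: if_splits)
    then show "\<exists>a c. a \<noteq> c \<and> \<not> E a c \<and> {v \<in> V - Z. p' v = s} = {a, c}"
      using cen(2)[OF s] by simp
  next
    fix v assume v: "v \<in> V - Z" "p' v \<noteq> v"
    show "E v (p' v)" using v edg(1)[of v] b(5) sym[OF b(5)] by (auto simp: p' split: if_splits)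
    assume nz: "p' v \<notin> Z"
    show "p' (p' v) = v"
    proof (cases "v = x \<or> v = b \<or> v = a")
      case True
      then show ?thesis using v bx ne b by (auto simp: p')
    next
      case False
      then have "p' v = p v" by (simp add: p')
      then have "p (p v) = v" using edg[of v] v nz by auto
      moreover have "p v \<noteq> x" "p v \<noteq> b" "p v \<noteq> a"
        using calculation False xV b b_def by auto
      ultimately show ?thesis using \<open>p' v = p v\<close> by (simp add: p')
    qed
  qed (use ZV pV xV aV b in \<open>auto simp: p'\<close>)
  moreover have s: "singles Z p' = insert a (singles Z p - {x})"
    using xV aV a ne b bx by (auto simp: singles_def p' split: if_splits)
  moreover have "a \<notin> singles Z p" using b b_def by (auto simp: singles_def)
  then have "card (singles Z p') = card (singles Z p)"
    using s x finite_singles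
    by (metis card_Suc_Diff1 card_insert_disjoint finite_Diff Diff_iff)
  ultimately show "optimal Z p'" "a \<in> singles Z p'"
    using opt by (auto simp: optimal_def)
qed

text \<open>\<open>x\<close> replaces \<open>a\<close> as a leaf of \<open>s\<close>. The new path
  is induced because, by \<open>optimal_edge\<close>, a single vertex is not adjacent to any leaf,
  in particular not to the remaining leaf \<open>c\<close>.\<close>

lemma star_shift:
  assumes opt: "optimal Z p" and x: "x \<in> singles Z p" and xs: "E x s" and s: "s \<in> Z"
    and a: "a \<in> V - Z" "p a = s"
  defines "p' \<equiv> p(a := a, x := s)"
  shows "optimal Z p'" "a \<in> singles Z p'"
proof -
  have pk: "packing Z p" using opt by (simp add: optimal_def)
  have xV: "x \<in> V" "x \<notin> Z" "p x = x" using x by (auto simp: singles_def)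
  have ne: "x \<noteq> a" using xV a s by auto
  have ZV: "Z \<subseteq> V" and pV: "\<And>v. v \<in> V \<Longrightarrow> p v \<in> V"
    and cen: "\<And>s. s \<in> Z \<Longrightarrow> p s = s"
      "\<And>s. s \<in> Z \<Longrightarrow> \<exists>a c. a \<noteq> c \<and> \<not> E a c \<and> {v \<in> V - Z. p v = s} = {a, c}"
    using pk unfolding packing_def by blast+
  note edg = packing_edge[OF pk]
  obtain a' c' where ac: "a' \<noteq> c'" "\<not> E a' c'" "{v \<in> V - Z. p v = s} = {a', c'}"
    using cen(2)[OF s] by blast
  have "a \<in> {v \<in> V - Z. p v = s}" using a by simp
  then obtain c where c: "c \<noteq> a" "{v \<in> V - Z. p v = s} = {a, c}"
    using ac by (metis insert_commute insert_iff singletonD)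
  have cV: "c \<in> V" "c \<notin> Z" "p c = s" using c by auto
  have xc: "\<not> E x c" using optimal_edge(2)[OF opt x, of c] cV s by auto
  have cx: "c \<noteq> x" using cV xV s by auto
  have "packing Z p'"
    unfolding packing_def
  proof (intro conjI ballI impI)
    fix t assume t: "t \<in> Z"
    then show "p' t = t" using cen xV a by (auto simp: p'_def)
    show "\<exists>a c. a \<noteq> c \<and> \<not> E a c \<and> {v \<in> V - Z. p' v = t} = {a, c}"
    proof (cases "t = s")
      case True
      have "{v \<in> V - Z. p' v = t} = {x, c}"
        using True c cV cx xV a s ne by (auto simp: p'_def split: if_splits)
      then show ?thesis using xc cx
        by (intro exI[of _ x] exI[of _ c]) simp
    next
      case False
      then have "{v \<in> V - Z. p' v = t} = {v \<in> V - Z. p v = t}"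
        using t xV a by (auto simp: p'_def)
      then show ?thesis using cen(2)[OF t] by simp
    qed
  next
    fix v assume v: "v \<in> V - Z" "p' v \<noteq> v"
    show "E v (p' v)" using v edg(1)[of v] xs by (auto simp: p'_def split: if_splits)
    assume nz: "p' v \<notin> Z"
    then have f: "v \<noteq> x" "v \<noteq> a" "p' v = p v" using s v ne by (auto simp: p'_def split: if_splits)
    then have "p (p v) = v" using edg[of v] v nz by auto
    moreover have "p v \<noteq> x" "p v \<noteq> a" using calculation f xV a v s by auto
    ultimately show "p' (p' v) = v" using f by (simp add: p'_def)
  qed (use ZV pV xV a s in \<open>auto simp: p'_def\<close>)
  moreover have eq: "singles Z p' = insert a (singles Z p - {x})"
    using xV a ne s by (auto simp: singles_def p'_def split: if_splits)
  moreover have "a \<notin> singles Z p" using a s by (auto simp: singles_def)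
  then have "card (singles Z p') = card (singles Z p)"
    using eq x finite_singles
    by (metis card_Suc_Diff1 card_insert_disjoint finite_Diff Diff_iff)
  ultimately show "optimal Z p'" "a \<in> singles Z p'"
    using opt by (auto simp: optimal_def)
qed

section \<open>From packings and even cliques to path decompositions\<close>

lemma induces_path_edge: "E a b \<Longrightarrow> induces_path E {a, b}"
  unfolding induces_path_def
  by (rule exI[of _ "[a, b]"]) (use irrefl sym in \<open>auto simp: less_Suc_eq\<close>)

lemma induces_path_star:
  "E a s \<Longrightarrow> E c s \<Longrightarrow> \<not> E a c \<Longrightarrow> a \<noteq> c \<Longrightarrow> induces_path E {s, a, c}"
  unfolding induces_path_def
  by (rule exI[of _ "[a, s, c]"]) (use irrefl sym in \<open>auto simp: less_Suc_eq\<close>)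

lemma packing_imp_IPD:
  assumes pk: "packing Z p" and none: "singles Z p = {}"
  shows "has_IPD V E"
proof -
  have ZV: "Z \<subseteq> V" and pV: "\<And>v. v \<in> V \<Longrightarrow> p v \<in> V"
    and pZ: "\<And>s. s \<in> Z \<Longrightarrow> p s = s"
    using pk unfolding packing_def by blast+
  have edg: "E v (p v)" "p v \<notin> Z \<Longrightarrow> p (p v) = v" if "v \<in> V" "v \<notin> Z" for v
    using packing_edge[OF pk, of v] that none unfolding singles_def by blast+
  \<comment> \<open>Keyed on \<open>p v\<close> rather than \<open>v\<close>, so that a centre,
    being fixed by \<open>p\<close>, falls into the same class as its two leaves.\<close>
  define part where "part v = (if p v \<in> Z then {u \<in> V. p u = p v} else {v, p v})" for v
  have part_self: "v \<in> part v" if "v \<in> V" for v using that by (simp add: part_def)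
  have part_eq: "part u = part v" if "v \<in> V" "u \<in> part v" for u v
  proof (cases "p v \<in> Z")
    case True
    then show ?thesis using that by (auto simp: part_def)
  next
    case False
    then have "v \<notin> Z" using pZ by auto
    then have "p (p v) = v" using edg that False by blast
    then show ?thesis using that False \<open>v \<notin> Z\<close> by (auto simp: part_def)
  qed
  have good: "card (part v) \<ge> 2 \<and> induces_path E (part v) \<and> part v \<subseteq> V" if "v \<in> V" for v
  proof (cases "p v \<in> Z")
    case True
    obtain a c where ac: "a \<noteq> c" "\<not> E a c" "{u \<in> V - Z. p u = p v} = {a, c}"
      using packing_centre[OF pk True] by blast
    have acV: "a \<in> V" "a \<notin> Z" "p a = p v" "c \<in> V" "c \<notin> Z" "p c = p v" using ac(3) by auto
    have "part v = insert (p v) {u \<in> V - Z. p u = p v}"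
      using True pZ ZV by (auto simp: part_def)
    then have eq: "part v = {p v, a, c}" using ac by simp
    have "E a (p v)" "E c (p v)" using edg(1)[of a] edg(1)[of c] acV by auto
    moreover have "p v \<noteq> a" "p v \<noteq> c" using True acV by auto
    ultimately show ?thesis using eq ac induces_path_star[of a "p v" c] acV True ZV by auto
  next
    case False
    then have "E v (p v)" using edg that pZ by metis
    then show ?thesis using False induces_path_edge[of v "p v"] irrefl[of v] that pV
      by (cases "p v = v") (auto simp: part_def)
  qed
  show ?thesis
    unfolding has_IPD_def
  proof (intro exI[of _ "part ` V"] conjI)
    show "\<Union> (part ` V) = V" using part_self good by blast
    show "\<forall>A\<in>part ` V. \<forall>B\<in>part ` V. A \<noteq> B \<longrightarrow> A \<inter> B = {}"
    proof (intro ballI impI)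
      fix A B assume "A \<in> part ` V" "B \<in> part ` V" "A \<noteq> B"
      then obtain u v where "u \<in> V" "A = part u" "v \<in> V" "B = part v" by blast
      then show "A \<inter> B = {}" using part_eq \<open>A \<noteq> B\<close> by (metis disjoint_iff)
    qed
    show "\<forall>A\<in>part ` V. 2 \<le> card A \<and> induces_path E A" using good by blast
  qed
qed

lemma even_clique_IPD:
  assumes "complete_graph V E" "even (card V)"
  shows "has_IPD V E"
proof -
  have "\<exists>P. \<Union>P = A \<and> (\<forall>B\<in>P. \<forall>C\<in>P. B \<noteq> C \<longrightarrow> B \<inter> C = {}) \<and>
      (\<forall>B\<in>P. card B = 2)" if "finite A" "even (card A)" for A :: "'a set"
    using that
  proof (induction "card A" arbitrary: A rule: less_induct)
    case less
    show ?case
    proof (cases "A = {}")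
      case False
      then have "card A \<noteq> 0" using less by simp
      then have "2 \<le> card A" using less(3) by presburger
      then obtain B where B: "B \<subseteq> A" "card B = 2" by (metis obtain_subset_with_card_n)
      have "finite B" using B less(2) finite_subset by metis
      then have cd: "card (A - B) = card A - 2" using B by (simp add: card_Diff_subset)
      then obtain P where P: "\<Union>P = A - B" "\<forall>B\<in>P. \<forall>C\<in>P. B \<noteq> C \<longrightarrow> B \<inter> C = {}"
        "\<forall>B\<in>P. card B = 2"
        using less(1)[of "A - B"] less(2,3) \<open>2 \<le> card A\<close> cd by auto
      have "\<Union>(insert B P) = A" using P(1) B by auto
      moreover have "\<forall>C\<in>P. C \<inter> B = {}" using P(1) by blast
      ultimately show ?thesis using P B
        by (intro exI[of _ "insert B P"]) (auto simp: Int_commute)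
    qed auto
  qed
  from this[OF fin assms(2)] obtain P where P: "\<Union>P = V"
    "\<forall>B\<in>P. \<forall>C\<in>P. B \<noteq> C \<longrightarrow> B \<inter> C = {}" "\<forall>B\<in>P. card B = 2" by blast
  have "induces_path E B" if "B \<in> P" for B
  proof -
    obtain a b where "B = {a, b}" "a \<noteq> b" using P(3) \<open>B \<in> P\<close> card_2_iff by metis
    moreover have "E a b"
      using calculation assms(1) P(1) \<open>B \<in> P\<close> unfolding complete_graph_def by blast
    ultimately show ?thesis using induces_path_edge by blast
  qed
  then show ?thesis using P unfolding has_IPD_def by (intro exI[of _ P]) auto
qed

lemma connected_closed_eq:
  assumes conn: "connected_graph V E" and K: "K \<subseteq> V" "K \<noteq> {}"
    and closed: "\<And>u v. u \<in> K \<Longrightarrow> E u v \<Longrightarrow> v \<in> K"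
  shows "K = V"
proof
  show "V \<subseteq> K"
  proof
    fix v assume "v \<in> V"
    obtain u where u: "u \<in> K" using K by blast
    then obtain xs where xs: "is_walk E xs" "hd xs = u" "last xs = v"
      using conn K \<open>v \<in> V\<close> unfolding connected_graph_def by blast
    then have ne: "xs \<noteq> []" and st: "\<And>i. Suc i < length xs \<Longrightarrow> E (xs ! i) (xs ! Suc i)"
      by (auto simp: is_walk_def)
    have "xs ! i \<in> K" if "i < length xs" for i
      using that
    proof (induction i)
      case 0
      then show ?case using u xs ne by (simp add: hd_conv_nth)
    next
      case (Suc i)
      then show ?case using closed st by (meson Suc_lessD)
    qed
    then show "v \<in> K" using xs(3) ne by (auto simp: last_conv_nth)
  qed
qed (rule K)

end

section \<open>Shifting a single vertex\<close>

locale deficient_packing = sgraph +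
  fixes Z :: "'a set" and p0 :: "'a \<Rightarrow> 'a" and x0 :: 'a
  assumes optimal0: "optimal Z p0" and single0: "x0 \<in> singles Z p0"
begin

text \<open>\<open>reach p x\<close>: shifting the single vertex \<open>x0\<close> of \<open>p0\<close> can lead to the packing \<open>p\<close> with \<open>x\<close>
  single instead.\<close>

inductive reach :: "('a \<Rightarrow> 'a) \<Rightarrow> 'a \<Rightarrow> bool" where
  init: "reach p0 x0"
| edge: "reach p x \<Longrightarrow> E x a \<Longrightarrow> a \<notin> Z \<Longrightarrow> reach (p(a := a, x := p a, p a := x)) a"
| star: "reach p x \<Longrightarrow> E x s \<Longrightarrow> s \<in> Z \<Longrightarrow> a \<in> V - Z \<Longrightarrow> p a = s \<Longrightarrow> reach (p(a := a, x := s)) a"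

definition D :: "'a set" where "D = {x. \<exists>p. reach p x}"

text \<open>The closure \<open>linked\<^sup>*\<^sup>*\<close> describes the components of G - Z; a
  vertex of \<open>Z\<close> is related only to itself.\<close>

definition linked :: "'a \<Rightarrow> 'a \<Rightarrow> bool" where
  "linked u v \<longleftrightarrow> E u v \<and> u \<notin> Z \<and> v \<notin> Z"

lemma reach_optimal: "reach p x \<Longrightarrow> optimal Z p \<and> x \<in> singles Z p"
proof (induction rule: reach.induct)
  case init
  show ?case using optimal0 single0 by blast
next
  case (edge p x a)
  then show ?case using edge_shift[of Z p x a] by blast
next
  case (star p x s a)
  then show ?case using star_shift[of Z p x s a] by blast
qed

lemma reach_single:
  assumes "reach p x"
  shows "x \<in> V" "x \<notin> Z" "p x = x"
  using reach_optimal[OF assms] by (auto simp: singles_def)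

lemma reach_packing: "reach p x \<Longrightarrow> packing Z p"
  using reach_optimal by (simp add: optimal_def)

lemma reach_edge:
  assumes "reach p x" "E x a" "a \<notin> Z"
  shows "p a \<noteq> a" "p a \<notin> Z" "E x (p a)" "E a (p a)" "p (p a) = a"
  using optimal_edge[of Z p x a] reach_optimal[OF assms(1)] assms
    packing_edge[OF reach_packing[OF assms(1)], of a] E_V[of x a] by blast+

lemma D_V: "x \<in> D \<Longrightarrow> x \<in> V \<and> x \<notin> Z"
  unfolding D_def using reach_single by blast

lemma D_closed: "x \<in> D \<Longrightarrow> E x a \<Longrightarrow> a \<notin> Z \<Longrightarrow> a \<in> D"
  unfolding D_def using reach.edge by blast

lemma D_linked: "linked\<^sup>*\<^sup>* u v \<Longrightarrow> u \<in> D \<Longrightarrow> v \<in> D"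
  by (induction rule: rtranclp_induct) (auto simp: linked_def intro: D_closed)

lemma symp_linked: "symp linked"
  unfolding symp_def linked_def using sym by blast

lemma linked_sym: "linked\<^sup>*\<^sup>* u v \<Longrightarrow> linked\<^sup>*\<^sup>* v u"
  by (rule sympD[OF symp_rtranclp[OF symp_linked]])

section \<open>Cycles in \<open>D\<close> span cliques\<close>

text \<open>Let \<open>d\<close> be the partner of \<open>c\<close> while \<open>u\<close> is
  single. After a shift to \<open>a\<close> or to \<open>e\<close>, \<open>optimal_edge\<close> for
  the edge from the new single vertex to \<open>c\<close> makes that vertex adjacent to
  \<open>d\<close>. If \<open>d\<close> is \<open>a\<close> or \<open>e\<close>, this is the edge
  sought; if \<open>a\<close> and \<open>e\<close> are partners, there is nothing to do.\<close>

lemma no_diamond: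
  assumes "u \<in> D" "E u a" "E u c" "E u e" "a \<notin> Z" "c \<notin> Z" "e \<notin> Z"
    and "E a c" "E c e" "a \<noteq> e"
  shows "E a e"
proof -
  obtain p where p: "reach p u" using assms(1) D_def by blast
  have pu: "p u = u" using reach_single p by blast
  have ne: "u \<noteq> a" "u \<noteq> c" "u \<noteq> e" "a \<noteq> c" "c \<noteq> e" using assms irrefl by metis+
  define b d f where "b = p a" and "d = p c" and "f = p e"
  note pa = reach_edge[OF p assms(2,5), folded b_def]
  note pc = reach_edge[OF p assms(3,6), folded d_def]
  note pe = reach_edge[OF p assms(4,7), folded f_def]
  have neu: "b \<noteq> u" "d \<noteq> u" "f \<noteq> u" using pa pc pe pu ne by auto
  have to_e: "reach (p(e := e, u := f, f := u)) e"
    using reach.edge[OF p assms(4,7)] by (simp add: f_def)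
  have to_a: "reach (p(a := a, u := b, b := u)) a"
    using reach.edge[OF p assms(2,5)] by (simp add: b_def)
  show ?thesis
  proof (cases "d = a \<or> d = e \<or> b = e")
    case True
    then consider "d = a" | "d = e" | "b = e" by blast
    then show ?thesis
    proof cases
      case 1
      then have "c \<noteq> f" using pe pc assms(10) by (auto simp: d_def)
      then have "E e a"
        using reach_edge(3)[OF to_e sym[OF assms(9)] assms(6)] ne 1 by (auto simp: d_def)
      then show ?thesis by (rule sym)
    next
      case 2
      then have "c \<noteq> b" using pa pc assms(10) by (auto simp: d_def)
      then show ?thesis
        using reach_edge(3)[OF to_a assms(8,6)] ne 2 by (auto simp: d_def)
    next
      case 3
      then show ?thesis using pa by simp
    qed
  next
    case False
    then have dis: "d \<noteq> a" "d \<noteq> e" "b \<noteq> e" "b \<noteq> c" "f \<noteq> c" "f \<noteq> a" "b \<noteq> d" "d \<noteq> f" "b \<noteq> f"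
      using pa pc pe ne assms(10) by (auto simp: b_def d_def f_def)
    have "E e d"
      using reach_edge(3)[OF to_e sym[OF assms(9)] assms(6)] ne dis by (auto simp: d_def)
    then have de: "E d e" by (rule sym)
    have ad: "E a d"
      using reach_edge(3)[OF to_a assms(8,6)] ne dis by (auto simp: d_def)
    \<comment> \<open>Now \<open>d\<close> is adjacent to \<open>a\<close> and \<open>e\<close>.
      Shifting from \<open>a\<close> to \<open>d\<close> makes \<open>{a, c}\<close> a piece, and
      shifting on to \<open>e\<close> preserves it; as \<open>e\<close> is adjacent to
      \<open>c\<close>, it must be adjacent to \<open>a\<close>.\<close>
    define pa where "pa = p(a := a, u := b, b := u)"
    have pa: "reach pa a" "pa d = c" "pa e = f"
      using to_a ne dis neu pc assms(10) by (auto simp: pa_def f_def)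
    define pd where "pd = pa(d := d, a := c, c := a)"
    have pd: "reach pd d" "pd c = a" "pd e = f"
      using reach.edge[OF pa(1) ad pc(2)] pa ne dis assms(10) by (auto simp: pd_def)
    have to_e2: "reach (pd(e := e, d := f, f := d)) e"
      using reach.edge[OF pd(1) de assms(7)] pd by simp
    have "E e a"
      using reach_edge(3)[OF to_e2 sym[OF assms(9)] assms(6)] ne dis pc(1) pd by auto
    then show ?thesis by (rule sym)
  qed
qed

text \<open>Edge shifts alter only the pieces of visited vertices, so a piece \<open>{y, z}\<close>
  disjoint from the walk survives.\<close>

lemma reach_walk:
  assumes "reach p x" "successively E (x # ws)" "set ws \<inter> Z = {}"
    and "y \<notin> set (x # ws)" "z \<notin> set (x # ws)" "p y = z" "p z = y"
  shows "\<exists>p'. reach p' (last (x # ws)) \<and> p' y = z \<and> p' z = y"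
  using assms
proof (induction ws arbitrary: p x)
  case (Cons a ws)
  let ?p = "p(a := a, x := p a, p a := x)"
  have xa: "E x a" "a \<notin> Z" using Cons.prems by auto
  have "p (p a) = a" using reach_edge[OF Cons.prems(1) xa] by simp
  then have "?p y = z" "?p z = y" using Cons.prems by auto
  then show ?case
    using Cons.IH[OF reach.edge[OF Cons.prems(1) xa]] Cons.prems by auto
qed auto

text \<open>The partner \<open>d\<close> of \<open>c\<close> is a common neighbour of
  \<open>u\<close> and \<open>c\<close>. If it is adjacent to the last vertex of the cycle,
  \<open>no_diamond\<close> at \<open>u\<close> applies. If \<open>d\<close> lies on the cycle
  before the last vertex, the shorter cycle from \<open>u\<close> through \<open>d\<close> gives
  this adjacency by induction.\<close>

lemma cycle_ends_adjacent:
  assumes "u \<in> D" "distinct (u # c # ws)" "successively E (u # c # ws)"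
    and "set (c # ws) \<inter> Z = {}" "ws \<noteq> []" "E (last ws) u"
  shows "E c (last ws)"
  using assms(2-)
proof (induction "length ws" arbitrary: c ws rule: less_induct)
  case less
  obtain p where p: "reach p u" using assms(1) D_def by blast
  have uc: "E u c" "c \<notin> Z" using less.prems by auto
  define d where "d = p c"
  note pc = reach_edge[OF p uc, folded d_def]
  have lst: "last ws \<in> set ws" "last ws \<notin> Z" "c \<noteq> last ws"
    using less.prems(1,3,4) last_in_set[of ws] by (auto simp del: last_in_set)
  have ul: "E u (last ws)" using less.prems sym by blast
  have diamond: "E c (last ws)" if "E d (last ws)"
    using no_diamond[OF assms(1) uc(1) pc(3) ul uc(2) pc(2) lst(2) pc(4) that lst(3)] .
  show ?case
  proof (cases "d \<in> set ws")
    case True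
    then obtain ws1 ws2 where ws: "ws = ws1 @ d # ws2" by (meson split_list)
    show ?thesis
    proof (cases "ws2 = []")
      case True
      then show ?thesis using pc ws by simp
    next
      case False
      have "successively E (d # ws2)" using less.prems(2) unfolding ws
        by (auto simp: successively_append_iff successively_Cons)
      then have "E d (last ws2)"
        using less.hyps[of ws2 d] less.prems ws False pc by auto
      then show ?thesis using diamond ws False by simp
    qed
  next
    case False
    have "d \<noteq> u" using pc reach_single[OF p] irrefl by blast
    \<comment> \<open>Shifting from \<open>u\<close> to \<open>c\<close> makes \<open>{u, d}\<close>
      a piece that the rest of the cycle avoids. Once the last vertex, a neighbour of
      \<open>u\<close>, is single, it must also be adjacent to \<open>d\<close>.\<close>
    have "\<exists>p'. reach p' (last (c # ws)) \<and> p' u = d \<and> p' d = u"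
      using reach_walk[OF reach.edge[OF p uc], of ws u d] less.prems False pc \<open>d \<noteq> u\<close>
      by (auto simp: d_def)
    then obtain p' where p': "reach p' (last ws)" "p' u = d" using less.prems by auto
    have "E (last ws) d" using reach_edge(3)[OF p'(1) less.prems(5)] D_V[OF assms(1)] p'(2) by auto
    then show ?thesis using diamond sym by blast
  qed
qed

text \<open>By \<open>cycle_ends_adjacent\<close>, deleting the first vertex leaves a shorter cycle,
  a clique by induction. Rotating by one deletes the second vertex instead, and these two vertices
  are joined by an edge of the cycle.\<close>

lemma cycle_clique:
  assumes "distinct xs" "successively E xs" "set xs \<inter> Z = {}" "set xs \<subseteq> D"
    and "E (last xs) (hd xs)" "a \<in> set xs" "b \<in> set xs" "a \<noteq> b"
  shows "E a b"
  using assms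
proof (induction "length xs" arbitrary: xs a b rule: less_induct)
  case less
  obtain u c ws where xs: "xs = u # c # ws"
    using less.prems(6-8) by (metis list.set_cases set_ConsD)
  show ?case
  proof (cases "ws = []")
    case True
    then show ?thesis using less.prems xs sym by auto
  next
    case False
    have step: "E a b" if ys: "ys = u # c # ws" "distinct ys" "successively E ys" "set ys = set xs"
      "length ys = length xs" "E (last ys) (hd ys)" "ws \<noteq> []" "a \<in> set (c # ws)" "b \<in> set (c # ws)"
      "a \<noteq> b"
      for ys u c ws a b
    proof -
      have "E c (last ws)"
        using cycle_ends_adjacent[of u c ws] ys less.prems(3,4) by auto
      then have "E (last (c # ws)) c" using sym ys(7) by simp
      then show ?thesis using less.hyps[of "c # ws" a b] ys less.prems(3,4) by auto
    qed
    obtain d ws' where ws: "ws = d # ws'" using False by (cases ws) auto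
    have rot: "E a b" if ab: "a \<in> insert u (set ws)" "b \<in> insert u (set ws)" "a \<noteq> b" for a b
    proof (rule step)
      show "c # ws @ [u] = c # d # (ws' @ [u])" using ws by simp
      show "distinct (c # ws @ [u])" using less.prems(1) xs by auto
      show "successively E (c # ws @ [u])"
        using less.prems(2,5) False unfolding xs append_Cons[symmetric] successively_append_iff
        by simp
      show "E (last (c # ws @ [u])) (hd (c # ws @ [u]))" using less.prems(2) xs by simp
    qed (use ab ws xs in auto)
    have "E a b" if "a \<in> set (c # ws)" "b \<in> set (c # ws)" "a \<noteq> b" for a b
      using step[of xs u c ws a b] less.prems that xs False by auto
    moreover have "E u c" "E c u" using less.prems(2) xs sym by auto
    ultimately show ?thesis using rot less.prems(6-8) unfolding xs by auto
  qed
qed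

text \<open>Moving the single vertex from \<open>x\<close> to \<open>q\<close> by edge shifts never
  affects a leaf, so \<open>q\<close> would end up both single and a leaf.\<close>

lemma leaf_not_linked:
  assumes "reach p x" "linked\<^sup>*\<^sup>* x q" "q \<notin> Z"
  shows "p q \<notin> Z"
proof
  assume q: "p q \<in> Z"
  from assms(2) have "\<exists>p'. reach p' q \<and> (\<forall>v. v \<notin> Z \<longrightarrow> p v \<in> Z \<longrightarrow> p' v = p v)"
  proof (induction rule: rtranclp_induct)
    case base
    then show ?case using assms by blast
  next
    case (step y z)
    then obtain p' where p': "reach p' y" "\<And>v. v \<notin> Z \<Longrightarrow> p v \<in> Z \<Longrightarrow> p' v = p v" by blast
    have yz: "E y z" "z \<notin> Z" "y \<notin> Z" using step by (auto simp: linked_def)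
    note e = reach_edge[OF p'(1) yz(1,2)]
    have "(p'(z := z, y := p' z, p' z := y)) v = p v" if v: "v \<notin> Z" "p v \<in> Z" for v
    proof -
      have "p' v \<in> Z" using p'(2) v by simp
      then have "v \<noteq> y" "v \<noteq> z" "v \<noteq> p' z" using e reach_single[OF p'(1)] yz by auto
      then show ?thesis using p'(2) v by simp
    qed
    then show ?case using reach.edge[OF p'(1) yz(1,2)] by blast
  qed
  then show False using q assms reach_single by metis
qed

section \<open>Edges from a component of G - Z to Z\<close>

lemma Z_subset: "Z \<subseteq> V"
  using reach_packing[OF reach.init] by (simp add: packing_def)

lemma finite_Z: "finite Z"
  using Z_subset fin by (rule finite_subset)

lemma finite_boundary: "finite {(v, s). linked\<^sup>*\<^sup>* q v \<and> s \<in> Z \<and> E v s}"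
proof (rule finite_subset)
  show "{(v, s). linked\<^sup>*\<^sup>* q v \<and> s \<in> Z \<and> E v s} \<subseteq> V \<times> V" using E_V by blast
qed (simp add: fin)

text \<open>The start of a longest path in a component lies in an end block, all of whose vertices but
  one send their remaining edges to \<open>Z\<close>.\<close>

lemma component_boundary:
  assumes reg: "regular V E r" and conn: "connected_graph V E" and q: "q \<in> D"
    and nc: "\<not> complete_graph V E"
  shows "0 < r \<and> r \<le> 2 * card {(v, s). linked\<^sup>*\<^sup>* q v \<and> s \<in> Z \<and> E v s}"
proof -
  define C where "C = {v. linked\<^sup>*\<^sup>* q v}"
  define B where "B = {(v, s). linked\<^sup>*\<^sup>* q v \<and> s \<in> Z \<and> E v s}"
  have finB: "finite B" unfolding B_def by (rule finite_boundary)
  have CD: "C \<subseteq> D" using D_linked q by (auto simp: C_def)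
  have CV: "C \<subseteq> V" and CZ: "C \<inter> Z = {}" using CD D_V by blast+
  have C_closed: "v \<in> C" if "u \<in> C" "E u v" "v \<notin> Z" for u v
    using that CZ rtranclp.rtrancl_into_rtrancl[of linked q u v]
    by (auto simp: C_def linked_def)
  have deg: "card {u \<in> V. E v u} = r" if "v \<in> V" for v
    using reg that by (simp add: regular_def degree_def)
  \<comment> \<open>Such a \<open>K\<close> would be all of \<open>V\<close> by connectedness,
    making the graph complete.\<close>
  have no_closed: False if "K \<subseteq> V" "K \<noteq> {}" "\<And>u v. u \<in> K \<Longrightarrow> E u v \<Longrightarrow> v \<in> K"
    "\<And>u v. u \<in> K \<Longrightarrow> v \<in> K \<Longrightarrow> u \<noteq> v \<Longrightarrow> E u v" for K
    using connected_closed_eq[OF conn that(1,2)] that(3,4) nc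
    unfolding complete_graph_def by blast
  define path where "path xs \<longleftrightarrow> xs \<noteq> [] \<and> distinct xs \<and> successively E xs \<and> set xs \<subseteq> C" for xs
  have "path [q]" by (simp add: path_def C_def)
  moreover have "length ys < Suc (card V)" if "path ys" for ys
  proof -
    have "card (set ys) \<le> card V" using that CV fin by (intro card_mono) (auto simp: path_def)
    then show ?thesis using that by (simp add: path_def distinct_card)
  qed
  ultimately obtain xs where xs: "path xs" and longest: "\<And>ys. path ys \<Longrightarrow> length ys \<le> length xs"
    using ex_has_greatest_nat[of path "[q]" length] by (metis less_imp_le)
  \<comment> \<open>Otherwise \<open>v\<close> could be put in front of a longest path of the
    component.\<close>
  have nbr_on: "v \<in> set ys" if "path ys" "length ys = length xs" "E (hd ys) v" "v \<notin> Z" for ys v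
  proof (rule ccontr)
    assume "v \<notin> set ys"
    moreover have "hd ys \<in> C" using that(1) by (auto simp: path_def)
    ultimately have "path (v # ys)"
      using that C_closed[of "hd ys" v] sym[of "hd ys" v] by (auto simp: path_def successively_Cons)
    then show False using longest[of "v # ys"] that(2) by simp
  qed
  have x: "xs \<noteq> []" "distinct xs" "successively E xs" "set xs \<subseteq> C" using xs by (auto simp: path_def)
  define v0 where "v0 = hd xs"
  have v0: "v0 \<in> C" "v0 \<in> V" "v0 = xs ! 0"
    using subsetD[OF x(4) hd_in_set[OF x(1)]] CV x(1) by (auto simp: v0_def hd_conv_nth)
  \<comment> \<open>The segment of the path up to the farthest neighbour of \<open>v0\<close>, at
    the largest index \<open>j\<close> in \<open>J\<close>, closes to a cycle, so its vertex set
    \<open>K\<close> will be a clique.\<close>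
  define J where "J = {i. i < length xs \<and> E v0 (xs ! i)}"
  have "finite J" by (simp add: J_def)
  show ?thesis
  proof (cases "J = {}")
    \<comment> \<open>All neighbours of \<open>v0\<close> lie in \<open>Z\<close>, so
      \<open>v0\<close> alone supplies \<open>r\<close> boundary edges.\<close>
    case True
    have v0Z: "u \<in> Z" if "E v0 u" for u
    proof (rule ccontr)
      assume "u \<notin> Z"
      then have "u \<in> set xs" using nbr_on[OF xs refl] that by (simp add: v0_def)
      then show False using True that by (auto simp: J_def in_set_conv_nth)
    qed
    have "0 < r"
    proof (rule ccontr)
      assume "\<not> 0 < r"
      then have "{u \<in> V. E v0 u} = {}" using deg[OF v0(2)] fin by simp
      then have "\<not> E v0 u" for u using E_V by blast
      then show False using no_closed[of "{v0}"] v0 by blast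
    qed
    moreover have "Pair v0 ` {u \<in> V. E v0 u} \<subseteq> B" using v0 v0Z by (auto simp: B_def C_def)
    then have "card (Pair v0 ` {u \<in> V. E v0 u}) \<le> card B" by (rule card_mono[OF finB])
    then have "r \<le> card B" using deg[OF v0(2)] by (simp add: card_image inj_on_def)
    ultimately show ?thesis unfolding B_def by simp
  next
    case False
    define j where "j = Max J"
    have "j \<in> J" using False \<open>finite J\<close> by (simp add: j_def)
    then have j: "j < length xs" "E v0 (xs ! j)" by (auto simp: J_def)
    have j_max: "k \<le> j" if "k < length xs" "E v0 (xs ! k)" for k
      using that \<open>finite J\<close> by (simp add: j_def J_def)
    have "j \<noteq> 0" using j v0 irrefl by metis
    define K where "K = set (take (Suc j) xs)"
    have K_nth: "xs ! i \<in> K" if "i \<le> j" for i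
      using that j by (auto simp: K_def in_set_conv_nth intro!: exI[of _ i])
    have KC: "K \<subseteq> C" using x(4) set_take_subset[of "Suc j" xs] by (auto simp: K_def)
    have cyc: "E a b" if ys: "path ys" "k < length ys" "E (hd ys) (ys ! k)"
      "a \<in> set (take (Suc k) ys)" "b \<in> set (take (Suc k) ys)" "a \<noteq> b" for ys k a b
    proof (rule cycle_clique[of "take (Suc k) ys"])
      have "successively E (take (Suc k) ys @ drop (Suc k) ys)" using ys by (simp add: path_def)
      then show "successively E (take (Suc k) ys)" unfolding successively_append_iff by blast
      have sub: "set (take (Suc k) ys) \<subseteq> C"
        using ys set_take_subset[of "Suc k" ys] by (auto simp: path_def)
      show "set (take (Suc k) ys) \<inter> Z = {}" "set (take (Suc k) ys) \<subseteq> D" using sub CZ CD by auto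
      have "last (take (Suc k) ys) = ys ! k" using ys(2) by (simp add: take_Suc_conv_app_nth)
      moreover have "hd (take (Suc k) ys) = hd ys" using ys(2) by (cases ys) auto
      ultimately show "E (last (take (Suc k) ys)) (hd (take (Suc k) ys))" using ys(3) sym by simp
    qed (use ys in \<open>auto simp: path_def\<close>)
    have clique: "E a b" if "a \<in> K" "b \<in> K" "a \<noteq> b" for a b
      using cyc[OF xs j(1)] j(2) that by (simp add: v0_def K_def)
    \<comment> \<open>Reversing the path up to index \<open>i\<close> gives a longest path that
      starts at \<open>xs ! i\<close>, so \<open>v\<close> lies on it. If \<open>v\<close> came
      after index \<open>j\<close>, the cycle closed by the edge from \<open>xs ! i\<close> to
      \<open>v\<close> would contain \<open>v0\<close> and make it adjacent to \<open>v\<close>,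
      against the choice of \<open>j\<close>.\<close>
    have stay: "v \<in> K" if i: "i < j" and v: "E (xs ! i) v" "v \<notin> Z" for i v
    proof -
      define A R where "A = take (Suc i) xs" and "R = drop (Suc i) xs"
      have AR: "xs = A @ R" by (simp add: A_def R_def)
      have len: "length A = Suc i" "R \<noteq> []" using i j by (auto simp: A_def R_def)
      then have "A \<noteq> []" by auto
      have hdA: "hd A = v0" using AR \<open>A \<noteq> []\<close> by (simp add: v0_def)
      have lastA: "last A = xs ! i" using AR len by (simp add: last_conv_nth nth_append \<open>A \<noteq> []\<close>)
      have hdR: "hd R = xs ! Suc i" using AR len by (simp add: hd_conv_nth nth_append)
      have "xs ! 0 \<noteq> xs ! Suc i" using nth_eq_iff_index_eq[OF x(2), of 0 "Suc i"] i j x(1) by simp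
      then have v0R: "E v0 (hd R)"
        using clique[of v0 "xs ! Suc i"] K_nth[of 0] K_nth[of "Suc i"] i v0 hdR by auto
      let ?ys = "rev A @ R"
      have "successively E A" "successively E R"
        using x(3) unfolding AR successively_append_iff by auto
      then have "successively E ?ys"
        unfolding successively_append_iff successively_rev
        using v0R hdA \<open>A \<noteq> []\<close> by (auto simp: last_rev intro: successively_mono sym)
      then have ys: "path ?ys" using x AR by (auto simp: path_def)
      have hdys: "hd ?ys = xs ! i" using \<open>A \<noteq> []\<close> lastA by (simp add: hd_append hd_rev)
      have "length ?ys = length xs" using AR by simp
      then have "v \<in> set ?ys" using nbr_on[OF ys] hdys v by simp
      then have "v \<in> set xs" using AR by auto
      then obtain k where k: "k < length xs" "v = xs ! k" by (auto simp: in_set_conv_nth)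
      show ?thesis
      proof (cases "k \<le> j")
        case True
        then show ?thesis using K_nth k by simp
      next
        case False
        then have ki: "k \<ge> length A" using i len by simp
        have yk: "?ys ! k = v" using ki k AR by (simp add: nth_append)
        have "v0 \<in> set (take (Suc k) ?ys)" using hdA \<open>A \<noteq> []\<close> ki by auto
        moreover have "v \<in> set (take (Suc k) ?ys)"
          using yk k(1) \<open>length ?ys = length xs\<close> take_Suc_conv_app_nth[of k ?ys]
          by (simp del: take_append)
        moreover have "v0 \<noteq> v"
          using k False v0 x(1,2) by (metis le0 nth_eq_iff_index_eq length_greater_0_conv)
        ultimately have "E v0 v"
          using cyc[OF ys, of k v0 v] yk hdys v k \<open>length ?ys = length xs\<close> by simp
        then show ?thesis using j_max k False by simp
      qed
    qed
    \<comment> \<open>Omits \<open>xs ! j\<close>, the only vertex of \<open>K\<close> that may have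
      neighbours outside both \<open>K\<close> and \<open>Z\<close>.\<close>
    define K' where "K' = set (take j xs)"
    have cK: "card K = Suc j" "card K' = j" "finite K" "finite K'"
      using x(2) j by (auto simp: K_def K'_def distinct_card)
    have K_ins: "K = insert (xs ! j) K'" using j by (simp add: K_def K'_def take_Suc_conv_app_nth)
    have nbrs: "{u \<in> V. E v u} = (K - {v}) \<union> {s \<in> Z. E v s}" if vK: "v \<in> K'" for v
    proof -
      obtain i where "i < j" "v = xs ! i" using vK j by (auto simp: K'_def in_set_conv_nth)
      then have "u \<in> K" if "E v u" "u \<notin> Z" for u using stay that by simp
      moreover have "v \<in> K" using vK K_ins by simp
      then have "E v u" if "u \<in> K - {v}" for u using clique[of v u] that by auto
      moreover have "u \<in> V" "u \<noteq> v" if "E v u" for u using E_V irrefl that by metis+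
      moreover have "K \<subseteq> V" using KC CV by simp
      ultimately show ?thesis by blast
    qed
    have split: "r = j + card {s \<in> Z. E v s}" if "v \<in> K'" for v
    proof -
      have "finite {s \<in> Z. E v s}" using finite_Z by simp
      moreover have "(K - {v}) \<inter> {s \<in> Z. E v s} = {}" using KC CZ by blast
      ultimately have "card ((K - {v}) \<union> {s \<in> Z. E v s}) = card (K - {v}) + card {s \<in> Z. E v s}"
        using cK by (intro card_Un_disjoint) auto
      moreover have "card (K - {v}) = j" using cK that K_ins by simp
      ultimately show ?thesis using deg[of v] nbrs[OF that] that K_ins KC CV by auto
    qed
    have v0K: "v0 \<in> K'" using v0 j \<open>j \<noteq> 0\<close> by (auto simp: K'_def in_set_conv_nth)
    \<comment> \<open>If \<open>j = r\<close>, every vertex of \<open>K\<close> has all its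
      \<open>r\<close> neighbours inside \<open>K\<close>, against \<open>no_closed\<close>.\<close>
    have "j \<noteq> r"
    proof
      assume jr: "j = r"
      have "v \<in> K" if "u \<in> K" "E u v" for u v
      proof (cases "u \<in> K'")
        case True
        have "finite {s \<in> Z. E u s}" using finite_Z by simp
        then have "{s \<in> Z. E u s} = {}" using split[OF True] jr by simp
        then show ?thesis using nbrs[OF True] that E_V by blast
      next
        case False
        have "K - {u} \<subseteq> {w \<in> V. E u w}" using clique that KC CV by blast
        moreover have "card (K - {u}) = card {w \<in> V. E u w}"
          using cK that jr deg[of u] KC CV by auto
        ultimately have "K - {u} = {w \<in> V. E u w}" using fin by (intro card_subset_eq) auto
        then show ?thesis using that E_V by blast
      qed
      then show False using no_closed[of K] KC CV v0K K_ins clique by blast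
    qed
    then obtain m where m: "r = j + m" "0 < m" using split[OF v0K] by auto
    have "Sigma K' (\<lambda>v. {s \<in> Z. E v s}) \<subseteq> B" using KC K_ins by (auto simp: B_def C_def)
    then have "card (Sigma K' (\<lambda>v. {s \<in> Z. E v s})) \<le> card B" by (rule card_mono[OF finB])
    moreover have "card (Sigma K' (\<lambda>v. {s \<in> Z. E v s})) = (\<Sum>v\<in>K'. card {s \<in> Z. E v s})"
      using cK finite_Z by (intro card_SigmaI) auto
    moreover have "(\<Sum>v\<in>K'. card {s \<in> Z. E v s}) = (\<Sum>v\<in>K'. m)"
      using split m by (intro sum.cong) auto
    \<comment> \<open>\<open>B\<close> contains \<open>m\<close> edges from each of the
      \<open>j\<close> vertices of \<open>K'\<close>, and \<open>j + m \<le> 2 * (j * m)\<close>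
      since both are positive.\<close>
    ultimately have "j * m \<le> card B" using cK by simp
    moreover have "j \<le> j * m" "m \<le> j * m" using m \<open>j \<noteq> 0\<close> by auto
    ultimately show ?thesis using m unfolding B_def by linarith
  qed
qed

section \<open>Roots and double counting of the edges at \<open>S\<close>\<close>

definition S :: "'a set" where "S = {s \<in> Z. \<exists>w\<in>D. E w s}"

definition roots :: "('a \<Rightarrow> 'a) \<Rightarrow> 'a \<Rightarrow> 'a set" where
  "roots p x = insert x {v \<in> V - Z. p v \<in> S}"

text \<open>The shift changes \<open>p\<close> only at \<open>x\<close>, \<open>a\<close> and
  \<open>p a\<close>, none of which \<open>p\<close> sends into \<open>Z\<close>.\<close>

lemma edge_shift_leaf:
  assumes "reach p x" "E x a" "a \<notin> Z" "p v \<in> Z"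
  shows "v \<noteq> a" "(p(a := a, x := p a, p a := x)) v = p v"
  using reach_edge[OF assms(1-3)] reach_single[OF assms(1)] assms(3,4) by auto

text \<open>Once a neighbour of \<open>s\<close> is single, a star shift can make either leaf of
  \<open>s\<close> single. The induction carries this back to \<open>p0\<close>: edge shifts and
  star shifts at other centres preserve the leaves of \<open>s\<close>, and before a star shift at
  \<open>s\<close> itself its leaves already lie in \<open>D\<close>.\<close>

lemma leaves_subset_D:
  assumes s: "s \<in> S"
  shows "{v \<in> V - Z. p0 v = s} \<subseteq> D"
proof -
  have sZ: "s \<in> Z" using s by (simp add: S_def)
  have star_D: "{v \<in> V - Z. p v = s} \<subseteq> D" if "reach p x" "E x s" for p x
    using reach.star[OF that sZ] unfolding D_def by blast
  have "{v \<in> V - Z. p v = s} \<subseteq> D \<longrightarrow> {v \<in> V - Z. p0 v = s} \<subseteq> D" if "reach p x" for p x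
    using that
  proof (induction rule: reach.induct)
    case (edge p x a)
    have "{v \<in> V - Z. p v = s} \<subseteq> {v \<in> V - Z. (p(a := a, x := p a, p a := x)) v = s}"
    proof
      fix v assume "v \<in> {v \<in> V - Z. p v = s}"
      then show "v \<in> {v \<in> V - Z. (p(a := a, x := p a, p a := x)) v = s}"
        using edge_shift_leaf(2)[OF edge(1-3), of v] sZ by (simp del: fun_upd_apply)
    qed
    then show ?case using edge.IH by (meson order_trans)
  next
    case (star p x t a)
    show ?case
    proof (cases "t = s")
      case True
      then show ?thesis using star star_D by blast
    next
      case False
      have "{v \<in> V - Z. p v = s} \<subseteq> {v \<in> V - Z. (p(a := a, x := t)) v = s}"
        using False star(5) reach_single[OF star(1)] sZ by auto
      then show ?thesis using star.IH by (meson order_trans)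
    qed
  qed simp
  moreover obtain w p where "reach p w" "E w s" using s by (auto simp: S_def D_def)
  ultimately show ?thesis using star_D by blast
qed

lemma roots_subset_D: "roots p0 x0 \<subseteq> D"
  using leaves_subset_D reach.init by (auto simp: roots_def D_def)

lemma card_roots: "card (roots p0 x0) = 2 * card S + 1"
proof -
  have SZ: "S \<subseteq> Z" by (auto simp: S_def)
  have pk: "packing Z p0" by (rule reach_packing[OF reach.init])
  have finS: "finite S" using SZ finite_Z by (rule finite_subset)
  have "card {v \<in> V - Z. p0 v = s} = 2" if "s \<in> S" for s
  proof -
    have sZ: "s \<in> Z" using that SZ by blast
    obtain a c where "a \<noteq> c" "\<not> E a c" "{v \<in> V - Z. p0 v = s} = {a, c}"
      by (rule packing_centre[OF pk sZ])
    then show ?thesis by simp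
  qed
  then have "card (\<Union>s\<in>S. {v \<in> V - Z. p0 v = s}) = (\<Sum>s\<in>S. 2)"
    using finS fin by (subst card_UN_disjoint) auto
  moreover have "(\<Union>s\<in>S. {v \<in> V - Z. p0 v = s}) = {v \<in> V - Z. p0 v \<in> S}" by auto
  ultimately have "card {v \<in> V - Z. p0 v \<in> S} = 2 * card S" by simp
  moreover have "x0 \<notin> {v \<in> V - Z. p0 v \<in> S}" using reach_single[OF reach.init] SZ by auto
  moreover have "finite {v \<in> V - Z. p0 v \<in> S}" using fin by simp
  ultimately show ?thesis
    unfolding roots_def by (subst card_insert_disjoint) simp_all
qed

text \<open>The number of roots in a component of \<open>G - Z\<close> is invariant under shifts, and once the
  single vertex has been moved into the component it is the only root there.\<close>

lemma roots_not_linked: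
  assumes "a \<in> roots p0 x0" "b \<in> roots p0 x0" "linked\<^sup>*\<^sup>* a b"
  shows "a = b"
proof -
  \<comment> \<open>At most one root lies in the component of \<open>a\<close>; this property passes
    backwards along \<open>reach\<close>.\<close>
  define U where "U p x \<longleftrightarrow> (\<forall>c\<in>roots p x. \<forall>d\<in>roots p x. linked\<^sup>*\<^sup>* a c \<longrightarrow> linked\<^sup>*\<^sup>* a d \<longrightarrow> c = d)"
    for p x
  have SZ: "S \<subseteq> Z" by (auto simp: S_def)
  have pull_back: "U p x \<longrightarrow> U p0 x0" if "reach p x" for p x
    using that
  proof (induction rule: reach.induct)
    case (edge p x y)
    let ?p = "p(y := y, x := p y, p y := x)"
    \<comment> \<open>\<open>y\<close> replaces \<open>x\<close> in the same component and was not a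
      leaf, and all leaves keep their centres, so distinct roots stay distinct.\<close>
    have leaf: "v \<noteq> y" "v \<in> roots ?p y" if "v \<in> roots p x" "v \<noteq> x" for v
      using that edge_shift_leaf[OF edge(1-3), of v] SZ by (auto simp: roots_def)
    have "linked x y" using edge reach_single[OF edge(1)] by (simp add: linked_def)
    then have xy: "linked\<^sup>*\<^sup>* a y" if "linked\<^sup>*\<^sup>* a x"
      using that by (meson rtranclp.rtrancl_into_rtrancl)
    have yr: "y \<in> roots ?p y" by (simp add: roots_def)
    have "U p x" if "U ?p y"
      unfolding U_def
    proof (intro ballI impI)
      fix c d assume cd: "c \<in> roots p x" "d \<in> roots p x" "linked\<^sup>*\<^sup>* a c" "linked\<^sup>*\<^sup>* a d"
      show "c = d"
        using that cd leaf[OF cd(1)] leaf[OF cd(2)] xy yr unfolding U_def by metis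
    qed
    then show ?case using edge.IH by blast
  next
    case (star p x s y)
    have "s \<in> S" using star by (auto simp: S_def D_def)
    then have "roots p x \<subseteq> roots (p(y := y, x := s)) y"
      using reach_single[OF star(1)] by (auto simp: roots_def)
    then have "U p x" if "U (p(y := y, x := s)) y" using that unfolding U_def by blast
    then show ?case using star.IH by blast
  qed simp
  \<comment> \<open>With \<open>a\<close> single, any other root is a leaf, which
    \<open>leaf_not_linked\<close> keeps out of the component of \<open>a\<close>.\<close>
  obtain p where p: "reach p a" using assms(1) roots_subset_D by (auto simp: D_def)
  have "c = a" if "c \<in> roots p a" "linked\<^sup>*\<^sup>* a c" for c
    using that leaf_not_linked[OF p that(2)] SZ by (auto simp: roots_def)
  then have "U p a" unfolding U_def by metis
  then have "U p0 x0" using pull_back p by blast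
  then show ?thesis using assms unfolding U_def by blast
qed

lemma complete_if_regular:
  assumes reg: "regular V E r" and conn: "connected_graph V E"
  shows "complete_graph V E"
proof (rule ccontr)
  assume nc: "\<not> complete_graph V E"
  let ?R = "roots p0 x0"
  define B where "B q = {(v, s). linked\<^sup>*\<^sup>* q v \<and> s \<in> Z \<and> E v s}" for q
  have b: "0 < r" "r \<le> 2 * card (B q)" if "q \<in> ?R" for q
    using component_boundary[OF reg conn _ nc, of q] that roots_subset_D by (auto simp: B_def)
  have finR: "finite ?R" using fin by (simp add: roots_def)
  have finS: "finite S" using finite_Z by (simp add: S_def)
  have "r * card ?R \<le> (\<Sum>q\<in>?R. 2 * card (B q))"
    using sum_mono[of ?R "\<lambda>_. r" "\<lambda>q. 2 * card (B q)"] b by (simp add: mult.commute)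
  also have "\<dots> = 2 * card (\<Union>q\<in>?R. B q)"
  proof -
    have "B q \<inter> B q' = {}" if "q \<in> ?R" "q' \<in> ?R" "q \<noteq> q'" for q q'
    proof (rule ccontr)
      assume "B q \<inter> B q' \<noteq> {}"
      then obtain v where "linked\<^sup>*\<^sup>* q v" "linked\<^sup>*\<^sup>* q' v" by (auto simp: B_def)
      then have "linked\<^sup>*\<^sup>* q q'" using linked_sym by (meson rtranclp_trans)
      then show False using roots_not_linked that by blast
    qed
    then have "card (\<Union>q\<in>?R. B q) = (\<Sum>q\<in>?R. card (B q))"
      using finR finite_boundary by (intro card_UN_disjoint) (auto simp: B_def)
    then show ?thesis by (simp add: sum_distrib_left)
  qed
  \<comment> \<open>A boundary edge ends in \<open>S\<close> because its other end is in
    \<open>D\<close>; \<open>prod.swap\<close> adapts the orientation of the pairs.\<close>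
  also have "card (\<Union>q\<in>?R. B q) \<le> card (prod.swap ` Sigma S (\<lambda>s. {v \<in> V. E s v}))"
  proof (rule card_mono)
    show "finite (prod.swap ` Sigma S (\<lambda>s. {v \<in> V. E s v}))" using finS fin by auto
    show "(\<Union>q\<in>?R. B q) \<subseteq> prod.swap ` Sigma S (\<lambda>s. {v \<in> V. E s v})"
    proof
      fix e assume "e \<in> (\<Union>q\<in>?R. B q)"
      then obtain q v s where e: "q \<in> ?R" "e = (v, s)" "linked\<^sup>*\<^sup>* q v" "s \<in> Z" "E v s"
        by (auto simp: B_def)
      then have "v \<in> D" using D_linked roots_subset_D by blast
      then have "(s, v) \<in> Sigma S (\<lambda>s. {v \<in> V. E s v})"
        using e sym[OF e(5)] D_V by (auto simp: S_def)
      then show "e \<in> prod.swap ` Sigma S (\<lambda>s. {v \<in> V. E s v})" using e(2) by force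
    qed
  qed
  also have "card (prod.swap ` Sigma S (\<lambda>s. {v \<in> V. E s v})) = (\<Sum>s\<in>S. card {v \<in> V. E s v})"
    using finS fin by (simp add: card_image)
  also have "\<dots> = r * card S"
  proof -
    have "card {v \<in> V. E s v} = r" if "s \<in> S" for s
      using reg that Z_subset by (auto simp: S_def regular_def degree_def)
    then show ?thesis by simp
  qed
  finally have "r * (2 * card S + 1) \<le> 2 * (r * card S)" using card_roots by simp
  moreover have "0 < r" using b(1)[of x0] by (simp add: roots_def)
  ultimately show False by simp
qed

end

theorem mainTheorem2:
  fixes V :: "'a set" and E :: "'a \<Rightarrow> 'a \<Rightarrow> bool" and r :: nat
  assumes "simple_graph V E"
    and "connected_graph V E"
    and "regular V E r"
    and "\<not> (complete_graph V E \<and> odd (card V))"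
  shows "has_IPD V E"
proof -
  interpret sgraph V E
    using assms(1) unfolding simple_graph_def by unfold_locales blast+
  \<comment> \<open>Leaving every vertex single is a packing, so an optimal one exists.\<close>
  have "packing {} id" by (simp add: packing_def)
  then obtain Z p where opt: "optimal Z p"
    using ex_has_least_nat[of "\<lambda>(Z, p). packing Z p" "({}, id)" "\<lambda>(Z, p). card (singles Z p)"]
    unfolding optimal_def by auto
  show ?thesis
  proof (cases "singles Z p = {}")
    case True
    then show ?thesis using packing_imp_IPD opt by (simp add: optimal_def)
  next
    case False
    then obtain x where "x \<in> singles Z p" by blast
    then interpret deficient_packing V E Z p x using opt by unfold_locales
    \<comment> \<open>The graph is then complete, hence of even order by assumption, and its
      vertices can be paired.\<close>
    show ?thesis using complete_if_regular even_clique_IPD assms by blast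
  qed
qed

end
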